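(* Let $n>0$. The set $\mathcal{SP}a(n)$ of semi-Padovan partitions of $n$ consists of all partitions $\lambda$ of $n$ satisfying the following three conditions: (a) $v_1(\lambda)$ has multiplicity one in $v(\lambda)$; (b) if $1<j\leq \ell(\lambda)$, then $v_j(\lambda)$ has multiplicity three in $v(\lambda)$ and $\lambda$ has at least two parts equal to $2^{v_j(\lambda)}$; (c) $2^{v_1(\lambda)}$ is not a part of $\lambda$.
   Context: A partition of $n$ is a weakly decreasing sequence (equivalently, a finite multiset) of positive integers with sum $n$; its length $\ell(\lambda)$ is its number of parts. $\mathrm{val}_2(m)$ is the $2$-adic valuation of the positive integer $m$. For a partition $\lambda=(\lambda_1,\ldots,\lambda_{\ell(\lambda)})$, $v(\lambda)=(v_1(\lambda),\ldots,v_{\ell(\lambda)}(\lambda))$ is the sequence obtained by arranging the numbers $\mathrm{val}_2(\lambda_i)$, $1\le i\le \ell(\lambda)$, in non-increasing order; multiplicity in $v(\lambda)$ is the number of occurrences in this sequence. Notation: $\lambda\sqcup\mu$ is the partition whose multiset of parts is the multiset union (multiplicities added) of the parts of $\lambda$ and $\mu$; $2\lambda$ is obtained by doubling every part of $\lambda$; if $\lambda$ has an odd part, $\lambda^{o+2}$ is obtained by adding $2$ to (one occurrence of) the largest odd part of $\lambda$. For a set $\mathcal S$ of partitions these operations are applied elementwise (giving $\emptyset$ if $\mathcal S=\emptyset$). The semi-Padovan partitions are defined recursively by $\mathcal{SP}a(0)=\{(\,)\}$ (the set containing the empty partition), $\mathcal{SP}a(1)=\emptyset$, $\mathcal{SP}a(3)=\{(3)\}$,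 $\mathcal{SP}a(2n)=2\,\mathcal{SP}a(n)$ for $n\ge1$, and $\mathcal{SP}a(2n+1)=\mathcal{SP}a(2n-1)^{o+2}\cup\big(\mathcal{SP}a(2n-2)\sqcup(1,1,1)\big)$ for $n\ge2$. *)

theory Defs
  imports "HOL-Library.Multiset" "HOL-Computational_Algebra.Primes"
begin

text \<open>A partition is represented by the finite multiset of its (positive) parts; its length is
  \<open>size\<close>, and \<open>\<mu> \<squnion> \<nu>\<close> is the multiset sum \<open>\<mu> + \<nu>\<close>.\<close>

definition partitions :: "nat \<Rightarrow> nat multiset set" where
  "partitions n = {\<mu>. 0 \<notin># \<mu> \<and> sum_mset \<mu> = n}"

definition v_seq :: "nat multiset \<Rightarrow> nat list" where
  "v_seq \<mu> = rev (sorted_list_of_multiset (image_mset (multiplicity 2) \<mu>))"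

text \<open>The \<open>j\<close>-th term of \<^const>\<open>v_seq\<close> is indexed from 1, so it is meaningful only for
  \<open>1 \<le> j \<le> size \<mu>\<close>.\<close>

definition v_nth :: "nat multiset \<Rightarrow> nat \<Rightarrow> nat" where
  "v_nth \<mu> j = v_seq \<mu> ! (j - 1)"

definition double_parts :: "nat multiset \<Rightarrow> nat multiset" where
  "double_parts \<mu> = image_mset (\<lambda>m. 2 * m) \<mu>"

text \<open>Adding 2 to one occurrence of the largest odd part. This is meaningful only if \<open>\<mu>\<close> has an
  odd part, which is automatic for partitions of odd numbers, the only ones it is applied to below.\<close>

definition odd_plus2 :: "nat multiset \<Rightarrow> nat multiset" where
  "odd_plus2 \<mu> = (let m = Max {m. m \<in># \<mu> \<and> odd m} in add_mset (m + 2) (\<mu> - {#m#}))"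

function SPa :: "nat \<Rightarrow> nat multiset set" where
  "SPa 0 = {{#}}"
| "SPa 1 = {}"
| "SPa 3 = {{#3#}}"
| "n \<ge> 1 \<Longrightarrow> SPa (2 * n) = double_parts ` SPa n"
| "n \<ge> 2 \<Longrightarrow> SPa (2 * n + 1) =
     odd_plus2 ` SPa (2 * n - 1) \<union> (\<lambda>\<mu>. \<mu> + {#1, 1, 1#}) ` SPa (2 * n - 2)"
proof -
  fix P :: bool and x :: nat
  assume P: "x = 0 \<Longrightarrow> P" "x = 1 \<Longrightarrow> P" "x = 3 \<Longrightarrow> P"
    "\<And>n. n \<ge> 1 \<Longrightarrow> x = 2 * n \<Longrightarrow> P" "\<And>n. n \<ge> 2 \<Longrightarrow> x = 2 * n + 1 \<Longrightarrow> P"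
  have "x = 0 \<or> x = 1 \<or> x = 3 \<or> (\<exists>n\<ge>1. x = 2 * n) \<or> (\<exists>n\<ge>2. x = 2 * n + 1)"
    by presburger
  with P show P by blast
qed (simp_all, (rule FalseE, presburger)+)
termination by (relation "Wellfounded.measure id") simp_all

end

theory Submission imports Defs begin

text \<open>Conditions (a)--(c) involve only the valuations of the parts and the multiplicities of powers
  of two as parts. Halving the even parts lowers all their valuations and exponents by one, so the
  conditions can be analysed recursively by splitting off the odd parts. If \<open>V\<close> is the largest valuation, then a partition satisfying the
  conditions has one of three shapes: it is a single odd part greater than \<open>1\<close> (when
  \<open>V = 0\<close>); or it has no odd part and is \<open>2\<nu>\<close>; or it has exactly three odd parts, two of
  them equal to \<open>1\<close>, and is \<open>(1, 1, a) \<squnion> 2\<nu>\<close>. In the last two shapes \<open>\<nu>\<close> satisfies the conditions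
  with \<open>V - 1\<close> in place of \<open>V\<close>, and conversely every such \<open>\<nu>\<close> is allowed
  (\<open>top_triples_double\<close>, \<open>top_triples_triple\<close>, \<open>top_triples_cases\<close>).

  The recursion for \<open>SPa\<close> builds exactly these shapes. The odd parts of the first and third shapes
  have odd sum, so partitions of even numbers are of the second shape. For an odd number, a partition
  of the third shape with \<open>a = 1\<close> comes from adjoining \<open>(1, 1, 1)\<close>, and one with
  \<open>a > 1\<close> comes from the one with \<open>a - 2\<close>, since \<open>a - 2\<close> is then the largest odd part; the first
  shape is the same increment starting from \<open>(3)\<close>.\<close>

section \<open>Partitions with a single top valuation and triples below it\<close>

abbreviation vals :: "nat multiset \<Rightarrow> nat multiset" where
  "vals \<mu> \<equiv> image_mset (multiplicity 2) \<mu>"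

text \<open>Naming the top valuation \<open>V\<close> explicitly lets doubling act on the conditions simply as
  \<open>V \<mapsto> Suc V\<close>.\<close>

definition top_triples :: "nat \<Rightarrow> nat multiset \<Rightarrow> bool" where
  "top_triples V \<mu> \<longleftrightarrow> count (vals \<mu>) V = 1 \<and> (\<forall>v\<in>#vals \<mu>. v \<le> V) \<and> 2 ^ V \<notin># \<mu> \<and>
     (\<forall>v\<in>#vals \<mu>. v \<noteq> V \<longrightarrow> count (vals \<mu>) v = 3 \<and> count \<mu> (2 ^ v) \<ge> 2)"

lemma top_triples_iff_count:
  "top_triples V \<mu> \<longleftrightarrow> count (vals \<mu>) V = 1 \<and> count \<mu> (2 ^ V) = 0 \<and>
     (\<forall>v. v \<noteq> V \<longrightarrow> count (vals \<mu>) v > 0 \<longrightarrow>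
        v < V \<and> count (vals \<mu>) v = 3 \<and> count \<mu> (2 ^ v) \<ge> 2)"
  unfolding top_triples_def not_in_iff count_greater_zero_iff
  by (auto simp: le_less)

section \<open>Peeling off the odd parts\<close>

lemma zero_in_double_parts_iff: "0 \<in># double_parts \<nu> \<longleftrightarrow> 0 \<in># \<nu>"
  by (auto simp: double_parts_def)

lemma even_if_in_double_parts: "x \<in># double_parts \<nu> \<Longrightarrow> even x"
  by (auto simp: double_parts_def)

lemma sum_mset_double_parts: "sum_mset (double_parts \<nu>) = 2 * sum_mset \<nu>"
  by (induction \<nu>) (simp_all add: double_parts_def)

lemma count_double_parts_double: "count (double_parts \<nu>) (2 * x) = count \<nu> x"
  by (induction \<nu>) (simp_all add: double_parts_def)

lemma vals_double_parts:
  assumes "0 \<notin># \<nu>"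
  shows "vals (double_parts \<nu>) = image_mset Suc (vals \<nu>)"
proof -
  have "multiplicity 2 (2 * x) = Suc (multiplicity 2 x)" if "x \<in># \<nu>" for x
    using that assms by (intro multiplicity_times_same) (auto intro: gr0I)
  then show ?thesis
    by (auto simp: double_parts_def multiset.map_comp intro!: image_mset_cong)
qed

lemma count_image_Suc:
  "count (image_mset Suc M) (Suc v) = count M v" "count (image_mset Suc M) 0 = 0"
  by (induction M) simp_all

lemma odd_parts_plus_double_parts:
  assumes "0 \<notin># \<mu>"
  obtains \<nu> where "\<mu> = filter_mset odd \<mu> + double_parts \<nu>" "0 \<notin># \<nu>"
proof -
  let ?\<nu> = "image_mset (\<lambda>m. m div 2) (filter_mset even \<mu>)"
  have "double_parts ?\<nu> = image_mset id (filter_mset even \<mu>)"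
    unfolding double_parts_def multiset.map_comp by (rule image_mset_cong) auto
  then have eq: "\<mu> = filter_mset odd \<mu> + double_parts ?\<nu>"
    using multiset_partition[of \<mu> odd] by simp
  moreover have "0 \<notin># ?\<nu>"
    using assms eq zero_in_double_parts_iff by (metis union_iff)
  ultimately show thesis by (rule that)
qed

lemma all_neq_Suc_iff:
  "(\<forall>v. v \<noteq> Suc V \<longrightarrow> P v) \<longleftrightarrow> P 0 \<and> (\<forall>v. v \<noteq> V \<longrightarrow> P (Suc v))"
proof safe
  fix v assume "P 0" "\<forall>v. v \<noteq> V \<longrightarrow> P (Suc v)" "v \<noteq> Suc V"
  then show "P v" by (cases v) auto
qed auto

text \<open>Doubling shifts all valuations by one and creates no new part with valuation zero.\<close>

lemma top_triples_double:
  assumes "0 \<notin># \<nu>"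
  shows "top_triples (Suc V) (double_parts \<nu>) \<longleftrightarrow> top_triples V \<nu>"
  unfolding top_triples_iff_count vals_double_parts[OF assms] all_neq_Suc_iff
  by (simp add: count_image_Suc count_double_parts_double)

text \<open>Three odd parts, two of them \<open>1\<close>, are precisely what condition (b) allows at valuation
  zero, and they do not interfere with the conditions at positive valuations.\<close>

lemma top_triples_triple:
  assumes "0 \<notin># \<nu>" "odd a"
  shows "top_triples (Suc V) ({#1, 1, a#} + double_parts \<nu>) \<longleftrightarrow> top_triples V \<nu>"
proof -
  have vals: "vals ({#1, 1, a#} + double_parts \<nu>) = {#0, 0, 0#} + image_mset Suc (vals \<nu>)"
    using assms by (simp add: vals_double_parts not_dvd_imp_multiplicity_0)
  have "2 * 2 ^ v \<noteq> a" for v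
    using assms by auto
  then have count: "count ({#1, 1, a#} + double_parts \<nu>) (2 ^ Suc v) = count \<nu> (2 ^ v)" for v
    by (auto simp: count_double_parts_double)
  show ?thesis
    unfolding top_triples_iff_count vals all_neq_Suc_iff count
    by (simp add: count_image_Suc)
qed

lemma top_triples_0_single: "a > 0 \<Longrightarrow> top_triples 0 {#a#} \<longleftrightarrow> odd a \<and> a > 1"
  by (auto simp: top_triples_def multiplicity_eq_zero_iff)

text \<open>The odd parts are the parts with valuation zero, so if \<open>V = 0\<close> there is one part in
  all, and otherwise there are none or three of them, with at least two ones.\<close>

lemma top_triples_cases [consumes 2, case_names single double triple]:
  assumes "top_triples V \<mu>" "0 \<notin># \<mu>"
  obtains a where "\<mu> = {#a#}" "odd a" "a > 1"
  | W \<nu> where "V = Suc W" "\<mu> = double_parts \<nu>" "0 \<notin># \<nu>" "top_triples W \<nu>"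
  | W \<nu> a where "V = Suc W" "\<mu> = {#1, 1, a#} + double_parts \<nu>" "odd a" "0 \<notin># \<nu>"
      "top_triples W \<nu>"
proof (cases V)
  case 0
  have "size \<mu> = count (vals \<mu>) 0"
  proof -
    have "vals \<mu> = image_mset (\<lambda>_. 0) \<mu>"
      using assms 0 by (intro image_mset_cong) (auto simp: top_triples_def)
    then show ?thesis by (simp add: image_mset_const_eq)
  qed
  then have "size \<mu> = 1"
    using assms 0 by (simp add: top_triples_def)
  then obtain a where "\<mu> = {#a#}"
    using size_1_singleton_mset by blast
  then show thesis
    using assms 0 that(1) top_triples_0_single[of a] by auto
next
  case (Suc W)
  obtain \<nu> where \<nu>: "\<mu> = filter_mset odd \<mu> + double_parts \<nu>" "0 \<notin># \<nu>"
    using odd_parts_plus_double_parts[OF assms(2)] .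
  have size_odd: "size (filter_mset odd \<mu>) = count (vals \<mu>) 0"
  proof -
    have "vals (filter_mset odd \<mu>) = image_mset (\<lambda>_. 0) (filter_mset odd \<mu>)"
      by (intro image_mset_cong) (simp add: not_dvd_imp_multiplicity_0)
    then have odds: "vals (filter_mset odd \<mu>) = replicate_mset (size (filter_mset odd \<mu>)) 0"
      unfolding image_mset_const_eq .
    have "vals \<mu> = replicate_mset (size (filter_mset odd \<mu>)) 0 + image_mset Suc (vals \<nu>)"
      using arg_cong[OF \<nu>(1), of vals]
      unfolding image_mset_union odds vals_double_parts[OF \<nu>(2)] .
    then show ?thesis by (simp add: count_image_Suc)
  qed
  show thesis
  proof (cases "filter_mset odd \<mu> = {#}")
    case True
    then have "\<mu> = double_parts \<nu>"
      using \<nu>(1) by (metis add_0)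
    moreover from this have "top_triples W \<nu>"
      using assms(1) Suc top_triples_double[OF \<nu>(2)] by blast
    ultimately show thesis
      using that(2) Suc \<nu>(2) by blast
  next
    case False
    then have "count (vals \<mu>) 0 > 0"
      using size_odd by (metis gr0I size_eq_0_iff_empty)
    then have three: "size (filter_mset odd \<mu>) = 3" and two: "count \<mu> 1 \<ge> 2"
      using assms(1) Suc size_odd unfolding top_triples_iff_count by (auto dest: spec[of _ 0])
    have "replicate_mset 2 1 \<subseteq># filter_mset odd \<mu>"
      using two by (simp add: count_le_replicate_mset_subset_eq[symmetric])
    then obtain R where R: "filter_mset odd \<mu> = replicate_mset 2 1 + R"
      using mset_subset_eq_exists_conv by blast
    then have "size R = 1" using three by simp
    then obtain a where "R = {#a#}"
      using size_1_singleton_mset by blast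
    with R have odds: "filter_mset odd \<mu> = {#1, 1, a#}"
      by (simp add: numeral_2_eq_2)
    then have "a \<in># filter_mset odd \<mu>" by simp
    then have "odd a" by simp
    moreover have \<mu>: "\<mu> = {#1, 1, a#} + double_parts \<nu>"
      using \<nu>(1) unfolding odds .
    moreover have "top_triples W \<nu>"
      using assms(1) top_triples_triple[OF \<nu>(2) \<open>odd a\<close>] unfolding Suc \<mu> by blast
    ultimately show thesis
      using that(3) Suc \<nu>(2) by blast
  qed
qed

section \<open>The recursion for semi-Padovan partitions\<close>

definition top_triples_partitions :: "nat \<Rightarrow> nat multiset set" where
  "top_triples_partitions n = {\<mu> \<in> partitions n. \<exists>V. top_triples V \<mu>}"

lemma top_triples_partitions_double:
  "top_triples_partitions (2 * n) = double_parts ` top_triples_partitions n" (is "?L = ?R")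
proof (intro equalityI subsetI)
  fix \<mu> assume "\<mu> \<in> ?L"
  then obtain V where V: "top_triples V \<mu>" "0 \<notin># \<mu>" and sum: "sum_mset \<mu> = 2 * n"
    by (auto simp: top_triples_partitions_def partitions_def)
  have even: "even (sum_mset \<mu>)" using sum by simp
  from V show "\<mu> \<in> ?R"
  proof (cases rule: top_triples_cases)
    case (double W \<nu>)
    then have "\<nu> \<in> top_triples_partitions n"
      using sum by (auto simp: top_triples_partitions_def partitions_def sum_mset_double_parts)
    with double show ?thesis by blast
  qed (use even in \<open>auto simp: sum_mset_double_parts\<close>)
next
  fix \<mu> assume "\<mu> \<in> ?R"
  then obtain \<nu> V where "\<mu> = double_parts \<nu>" "top_triples V \<nu>" "0 \<notin># \<nu>" "sum_mset \<nu> = n"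
    by (auto simp: top_triples_partitions_def partitions_def)
  moreover from this have "top_triples (Suc V) \<mu>"
    using top_triples_double by blast
  ultimately show "\<mu> \<in> ?L"
    by (auto simp: top_triples_partitions_def partitions_def sum_mset_double_parts
        zero_in_double_parts_iff)
qed

lemma top_triples_partitions_triple:
  assumes "odd a" "\<nu> \<in> top_triples_partitions n"
  shows "{#1, 1, a#} + double_parts \<nu> \<in> top_triples_partitions (a + 2 + 2 * n)"
proof -
  obtain V where V: "top_triples V \<nu>" and \<nu>: "0 \<notin># \<nu>" "sum_mset \<nu> = n"
    using assms(2) by (auto simp: top_triples_partitions_def partitions_def)
  have "top_triples (Suc V) ({#1, 1, a#} + double_parts \<nu>)"
    using top_triples_triple[OF \<nu>(1) assms(1)] V by blast
  moreover have "{#1, 1, a#} + double_parts \<nu> \<in> partitions (a + 2 + 2 * n)"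
    using \<nu> odd_pos[OF assms(1)]
    by (simp add: partitions_def sum_mset_double_parts zero_in_double_parts_iff)
  ultimately show ?thesis
    unfolding top_triples_partitions_def by blast
qed

lemma top_triples_partitions_single:
  assumes "odd a" "a > 1"
  shows "{#a#} \<in> top_triples_partitions a"
  using assms top_triples_0_single[of a]
  by (auto simp: top_triples_partitions_def partitions_def)

lemma top_triples_partitions_odd_cases [consumes 2, case_names single triple]:
  assumes "odd n" "\<mu> \<in> top_triples_partitions n"
  obtains "\<mu> = {#n#}" "n > 1"
  | m \<nu> a where "n = a + 2 + 2 * m" "\<mu> = {#1, 1, a#} + double_parts \<nu>" "odd a"
      "\<nu> \<in> top_triples_partitions m"
proof -
  obtain V where V: "top_triples V \<mu>" "0 \<notin># \<mu>" and sum: "sum_mset \<mu> = n"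
    using assms by (auto simp: top_triples_partitions_def partitions_def)
  from V show thesis
  proof (cases rule: top_triples_cases)
    case (single a)
    then show thesis using that(1) sum by simp
  next
    case (double W \<nu>)
    then show thesis using assms(1) sum by (auto simp: sum_mset_double_parts)
  next
    case (triple W \<nu> a)
    then show thesis
      using that(2)[of a "sum_mset \<nu>" \<nu>] sum
      by (auto simp: top_triples_partitions_def partitions_def sum_mset_double_parts)
  qed
qed

lemma odd_plus2_single: "odd a \<Longrightarrow> odd_plus2 {#a#} = {#a + 2#}"
proof -
  assume "odd a"
  then have "{m. m \<in># {#a#} \<and> odd m} = {a}" by auto
  then show ?thesis by (simp add: odd_plus2_def)
qed

lemma odd_plus2_triple:
  assumes "odd a"
  shows "odd_plus2 ({#1, 1, a#} + double_parts \<nu>) = {#1, 1, a + 2#} + double_parts \<nu>"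
proof -
  have "{m. m \<in># {#1, 1, a#} + double_parts \<nu> \<and> odd m} = {1, a}"
    using assms even_if_in_double_parts by auto
  moreover have "Max {1, a} = a"
    using odd_pos[OF assms] by simp
  ultimately show ?thesis
    by (simp add: odd_plus2_def)
qed

text \<open>The largest odd part \<open>a\<close> decides which branch produced the partition: \<open>a > 1\<close> can be
  lowered by \<open>2\<close> and stays largest among the odd parts, while \<open>a = 1\<close> leaves \<open>(1, 1, 1)\<close> to
  be removed. A single part has \<open>a = 2n + 1\<close>, and \<open>n \<ge> 2\<close> keeps \<open>a - 2\<close> above \<open>1\<close>.\<close>

lemma top_triples_partitions_odd:
  assumes "n \<ge> 2"
  shows "top_triples_partitions (2 * n + 1) =
    odd_plus2 ` top_triples_partitions (2 * n - 1) \<union>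
    (\<lambda>\<mu>. \<mu> + {#1, 1, 1#}) ` top_triples_partitions (2 * n - 2)" (is "?L = ?A \<union> ?B")
proof (intro equalityI subsetI)
  have odd: "odd (2 * n + 1)" by simp
  fix \<mu> assume "\<mu> \<in> ?L"
  with odd show "\<mu> \<in> ?A \<union> ?B"
  proof (cases rule: top_triples_partitions_odd_cases)
    case single
    have "{#2 * n - 1#} \<in> top_triples_partitions (2 * n - 1)"
      using assms by (intro top_triples_partitions_single) auto
    moreover have "\<mu> = odd_plus2 {#2 * n - 1#}"
      using single assms by (subst odd_plus2_single) auto
    ultimately show ?thesis by blast
  next
    case (triple m \<nu> a)
    show ?thesis
    proof (cases "a = 1")
      case True
      then have "2 * n - 2 = 2 * m" using triple by simp
      then have "double_parts \<nu> \<in> top_triples_partitions (2 * n - 2)"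
        using triple top_triples_partitions_double by auto
      moreover have "\<mu> = double_parts \<nu> + {#1, 1, 1#}"
        using triple True by simp
      ultimately show ?thesis by blast
    next
      case False
      define b where "b = a - 2"
      have b: "a = b + 2" "odd b"
        using \<open>odd a\<close> False odd_pos[of a] unfolding b_def by presburger+
      then have "2 * n - 1 = b + 2 + 2 * m" using triple by simp
      then have "{#1, 1, b#} + double_parts \<nu> \<in> top_triples_partitions (2 * n - 1)"
        using top_triples_partitions_triple[OF b(2)] triple by simp
      moreover have "\<mu> = odd_plus2 ({#1, 1, b#} + double_parts \<nu>)"
        using triple b odd_plus2_triple by simp
      ultimately show ?thesis by blast
    qed
  qed
next
  fix \<mu> assume "\<mu> \<in> ?A \<union> ?B"
  then show "\<mu> \<in> ?L"
  proof
    assume "\<mu> \<in> ?A"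
    then obtain \<kappa> where \<kappa>: "\<kappa> \<in> top_triples_partitions (2 * n - 1)" "\<mu> = odd_plus2 \<kappa>" by blast
    have odd: "odd (2 * n - 1)" using assms by simp
    from odd \<kappa>(1) show "\<mu> \<in> ?L"
    proof (cases rule: top_triples_partitions_odd_cases)
      case single
      have "2 * n - 1 + 2 = 2 * n + 1" using assms by simp
      then have "\<mu> = {#2 * n + 1#}"
        using \<kappa>(2) single odd_plus2_single[OF odd] by simp
      then show ?thesis
        using top_triples_partitions_single[of "2 * n + 1"] assms by simp
    next
      case (triple m \<nu> a)
      then have "2 * n + 1 = (a + 2) + 2 + 2 * m" using assms by simp
      moreover have "\<mu> = {#1, 1, a + 2#} + double_parts \<nu>"
        using \<kappa>(2) triple odd_plus2_triple by simp
      ultimately show ?thesis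
        using top_triples_partitions_triple[of "a + 2" \<nu> m] triple by simp
    qed
  next
    assume "\<mu> \<in> ?B"
    moreover have "2 * n - 2 = 2 * (n - 1)" by simp
    ultimately obtain \<nu> where "\<nu> \<in> top_triples_partitions (n - 1)"
      "\<mu> = {#1, 1, 1#} + double_parts \<nu>"
      by (auto simp: top_triples_partitions_double)
    moreover have "1 + 2 + 2 * (n - 1) = 2 * n + 1" using assms by simp
    ultimately show "\<mu> \<in> ?L"
      using top_triples_partitions_triple[of 1 \<nu> "n - 1"] by simp
  qed
qed

lemma top_triples_partitions_1: "top_triples_partitions 1 = {}"
proof -
  have False if "\<mu> \<in> top_triples_partitions 1" for \<mu>
    using odd_one that by (cases rule: top_triples_partitions_odd_cases) auto
  then show ?thesis by blast
qed

lemma top_triples_partitions_3: "top_triples_partitions 3 = {{#3#}}"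
proof (intro equalityI subsetI)
  \<comment> \<open>The third shape at \<open>3\<close> would be \<open>(1, 1, 1)\<close>, over the empty partition, which has no top valuation.\<close>
  have empty: "top_triples_partitions 0 = {}"
  proof -
    have "partitions 0 = {{#}}"
      by (auto simp: partitions_def) (metis multiset_nonemptyE)
    then show ?thesis
      by (auto simp: top_triples_partitions_def top_triples_def)
  qed
  have odd: "odd (3::nat)" by simp
  fix \<mu> assume "\<mu> \<in> top_triples_partitions 3"
  with odd show "\<mu> \<in> {{#3#}}"
  proof (cases rule: top_triples_partitions_odd_cases)
    case (triple m \<nu> a)
    then have "m = 0" by (cases m) auto
    with triple empty show ?thesis by simp
  qed simp
qed (use top_triples_partitions_single[of 3] in simp)

lemma SPa_eq_top_triples_partitions: "n > 0 \<Longrightarrow> SPa n = top_triples_partitions n"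
proof (induction n rule: SPa.induct)
  case 2
  show ?case unfolding SPa.simps(2) top_triples_partitions_1 ..
next
  case 3
  show ?case unfolding SPa.simps(3) top_triples_partitions_3 ..
next
  case (4 n)
  then show ?case by (simp add: top_triples_partitions_double)
next
  case (5 n)
  then show ?case by (simp add: top_triples_partitions_odd del: One_nat_def)
qed simp

section \<open>The sequence of valuations\<close>

text \<open>In a non-increasing list whose head does not recur, the later entries are exactly the
  values different from the head; this is how the indices \<open>j > 1\<close> disappear.\<close>

lemma ex_top_triples_iff_v_seq:
  assumes "\<mu> \<noteq> {#}"
  shows "(\<exists>V. top_triples V \<mu>) \<longleftrightarrow>
    count_list (v_seq \<mu>) (v_nth \<mu> 1) = 1 \<and>
    (\<forall>j. 1 < j \<and> j \<le> size \<mu> \<longrightarrow>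
      count_list (v_seq \<mu>) (v_nth \<mu> j) = 3 \<and> count \<mu> (2 ^ v_nth \<mu> j) \<ge> 2) \<and>
    2 ^ v_nth \<mu> 1 \<notin># \<mu>"
proof -
  have mset: "mset (v_seq \<mu>) = vals \<mu>"
    by (simp add: v_seq_def)
  then have len: "length (v_seq \<mu>) = size \<mu>"
    using size_mset[of "v_seq \<mu>"] by simp
  with assms obtain V xs where xs: "v_seq \<mu> = V # xs"
    by (cases "v_seq \<mu>") auto
  have "sorted (rev (v_seq \<mu>))"
    by (simp add: v_seq_def)
  then have le: "\<forall>v\<in>set xs. v \<le> V"
    by (simp add: xs sorted_append)
  have vals: "vals \<mu> = add_mset V (mset xs)"
    using mset xs by simp
  have count: "count_list (v_seq \<mu>) v = count (vals \<mu>) v" for v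
    by (simp add: mset[symmetric] count_mset)
  have first: "v_nth \<mu> 1 = V"
    by (simp add: v_nth_def xs)
  have later: "(\<forall>j. 1 < j \<and> j \<le> size \<mu> \<longrightarrow> P (v_nth \<mu> j)) \<longleftrightarrow> (\<forall>v\<in>set xs. P v)"
    for P :: "nat \<Rightarrow> bool"
  proof -
    have "(\<forall>j. 1 < j \<and> j \<le> size \<mu> \<longrightarrow> P (v_nth \<mu> j)) \<longleftrightarrow> (\<forall>i<length xs. P (xs ! i))"
    proof (intro iffI allI impI)
      fix i assume "\<forall>j. 1 < j \<and> j \<le> size \<mu> \<longrightarrow> P (v_nth \<mu> j)" "i < length xs"
      then show "P (xs ! i)"
        using len[symmetric] by (auto simp: xs v_nth_def dest: spec[of _ "i + 2"])
    next
      fix j assume "\<forall>i<length xs. P (xs ! i)" "1 < j \<and> j \<le> size \<mu>"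
      then show "P (v_nth \<mu> j)"
        using len[symmetric] by (cases j; cases "j - 1") (auto simp: xs v_nth_def)
    qed
    then show ?thesis by (simp add: all_set_conv_all_nth)
  qed
  have top: "top_triples W \<mu> \<Longrightarrow> W = V" for W
    using le unfolding top_triples_def vals by (metis count_eq_zero_iff zero_neq_one
      dual_order.antisym insert_iff set_mset_add_mset_insert set_mset_mset)
  have "top_triples V \<mu> \<longleftrightarrow>
    count (vals \<mu>) V = 1 \<and>
    (\<forall>v\<in>set xs. count (vals \<mu>) v = 3 \<and> count \<mu> (2 ^ v) \<ge> 2) \<and> 2 ^ V \<notin># \<mu>"
    using le unfolding top_triples_def vals by (auto simp: not_in_iff)
  then show ?thesis
    unfolding count first later[of "\<lambda>v. count (vals \<mu>) v = 3 \<and> count \<mu> (2 ^ v) \<ge> 2"]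
    using top by metis
qed

theorem theorem5p2:
  fixes n :: nat
  assumes "n > 0"
  shows "SPa n = {\<mu> \<in> partitions n.
    count_list (v_seq \<mu>) (v_nth \<mu> 1) = 1 \<and>
    (\<forall>j. 1 < j \<and> j \<le> size \<mu> \<longrightarrow>
      count_list (v_seq \<mu>) (v_nth \<mu> j) = 3 \<and> count \<mu> (2 ^ v_nth \<mu> j) \<ge> 2) \<and>
    2 ^ v_nth \<mu> 1 \<notin># \<mu>}"
proof -
  have "\<mu> \<noteq> {#}" if "\<mu> \<in> partitions n" for \<mu>
    using that assms by (auto simp: partitions_def)
  then show ?thesis
    unfolding SPa_eq_top_triples_partitions[OF assms] top_triples_partitions_def
    using ex_top_triples_iff_v_seq by blast
qed

end
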